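(* Let $n\ge1$, let $k\in\mathbb Z^+$, and let $\beta\in A_1$ be any odd virtual symbol. Then, in $\mathbf{U}(gl(m_0|m_1+n))$, for every $e_{i,j}\in gl(n)$ ($i,j\in\{1,\dots,n\}$), $$ad(e_{i,j})\Big(\sum_{(h_1,\dots,h_n)}\frac{1}{h_1!\,h_2!\cdots h_n!}\; e_{n,\beta}^{h_n}\cdots e_{2,\beta}^{h_2}e_{1,\beta}^{h_1}\;e_{\beta,1}^{h_1}e_{\beta,2}^{h_2}\cdots e_{\beta,n}^{h_n}\Big)=0,$$ where the sum is over all $n$-tuples $(h_1,\dots,h_n)$ of nonnegative integers with $h_1+\cdots+h_n=k$.
   Context: $gl(m_0|m_1+n)$ (with $m_1\ge 1$) is the complex general linear Lie superalgebra with standard basis $e_{a,b}$, where $a,b\in A_0\cup A_1\cup L$, $A_0=\{\alpha_1,\dots,\alpha_{m_0}\}$ (symbols of parity $0$), $A_1=\{\beta_1,\dots,\beta_{m_1}\}$ (parity $1$), $L=\{1,\dots,n\}$ (parity $1$); symbols in $A_0\cup A_1$ are called virtual. The parity of $e_{a,b}$ is $|e_{a,b}|=|a|+|b|\in\mathbb Z_2$ and the supercommutator is $[e_{a,b},e_{c,d}]=\delta_{bc}e_{a,d}-(-1)^{(|a|+|b|)(|c|+|d|)}\delta_{ad}e_{c,b}$. The Lie algebra $gl(n)$ is the (even) subalgebra spanned by $e_{i,j}$, $i,j\in L$; for $e_{i,j}\in gl(n)$, $ad(e_{i,j})$ denotes the adjoint action on $\mathbf{U}(gl(m_0|m_1+n))$,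 $ad(e_{i,j})(u)=e_{i,j}u-u\,e_{i,j}$. *)

theory Defs
  imports
    Complex_Main
    "HOL-Library.Poly_Mapping"
    "HOL-Library.FuncSet"
    "HOL-Algebra.QuotRing"
begin

subsection \<open>The general linear Lie superalgebra\<close>

text \<open>
  The symbols: \<open>Alpha s\<close> and \<open>Beta t\<close> are the virtual symbols of parity 0 and 1,
  \<open>Prop i\<close> is the (proper, odd) symbol \<open>i\<close> of \<open>L = {1..n}\<close>. Since \<open>m0\<close> may be 0 and all
  three sizes are arbitrary, they are carried as natural number parameters.
\<close>

datatype symb = Alpha nat | Beta nat | Prop nat

definition symbols :: "nat \<Rightarrow> nat \<Rightarrow> nat \<Rightarrow> symb set" where
  "symbols m0 m1 n = Alpha ` {1..m0} \<union> Beta ` {1..m1} \<union> Prop ` {1..n}"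

primrec parity :: "symb \<Rightarrow> nat" where
  "parity (Alpha _) = 0"
| "parity (Beta _) = 1"
| "parity (Prop _) = 1"

text \<open>
  An element of the Lie superalgebra is the finitely supported family of its coordinates in
  the standard basis; the basis vector \<open>e\<^sub>a\<^sub>b\<close> is indexed by the pair \<open>(a, b)\<close>.
\<close>

type_synonym gl_elem = "(symb \<times> symb) \<Rightarrow>\<^sub>0 complex"

definition gl :: "nat \<Rightarrow> nat \<Rightarrow> nat \<Rightarrow> gl_elem set" where
  "gl m0 m1 n = {x. Poly_Mapping.keys x \<subseteq> symbols m0 m1 n \<times> symbols m0 m1 n}"

definition elem :: "symb \<Rightarrow> symb \<Rightarrow> gl_elem" where
  "elem a b = Poly_Mapping.single (a, b) 1"

definition homogeneous :: "nat \<Rightarrow> gl_elem \<Rightarrow> bool" where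
  "homogeneous d x \<longleftrightarrow> (\<forall>(a, b)\<in>Poly_Mapping.keys x. (parity a + parity b) mod 2 = d)"

text \<open>The supercommutator is the bilinear extension of the formula on the basis,
  see \<open>supercomm_elem\<close> below.\<close>

definition supercomm :: "gl_elem \<Rightarrow> gl_elem \<Rightarrow> gl_elem" where
  "supercomm x y =
     (\<Sum>(a, b)\<in>Poly_Mapping.keys x. \<Sum>(c, d)\<in>Poly_Mapping.keys y.
        let t = Poly_Mapping.lookup x (a, b) * Poly_Mapping.lookup y (c, d) in
          (if b = c then Poly_Mapping.single (a, d) t else 0)
        - (if a = d then Poly_Mapping.single (c, b)
             ((-1) ^ ((parity a + parity b) * (parity c + parity d)) * t) else 0))"

lemma supercomm_elem:
  "supercomm (elem a b) (elem c d) =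
     (if b = c then elem a d else 0)
   - (if a = d then Poly_Mapping.single (c, b)
        ((-1) ^ ((parity a + parity b) * (parity c + parity d))) else 0)"
proof -
  have "Poly_Mapping.keys (elem a b) = {(a, b)}" for a b
    by (simp add: elem_def)
  then show ?thesis
    unfolding supercomm_def
    by (simp only: sum.insert_if sum.empty finite.emptyI empty_iff if_False prod.case Let_def
        mult_1_right add_0_right elem_def lookup_single_eq)
qed

lemma gl_supercomm:
  assumes "x \<in> gl m0 m1 n" "y \<in> gl m0 m1 n"
  shows "supercomm x y \<in> gl m0 m1 n"
proof -
  have zero: "0 \<in> gl m0 m1 n"
    by (simp add: gl_def)
  have minus: "f - g \<in> gl m0 m1 n" if "f \<in> gl m0 m1 n" "g \<in> gl m0 m1 n" for f g
    using that keys_diff[of f g] unfolding gl_def by blast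
  have sum: "sum f A \<in> gl m0 m1 n" if "\<And>a. a \<in> A \<Longrightarrow> f a \<in> gl m0 m1 n"
    for f and A :: "(symb \<times> symb) set"
    using that keys_sum[of f A] unfolding gl_def by blast
  have single: "Poly_Mapping.single (a, b) t \<in> gl m0 m1 n"
    if "a \<in> symbols m0 m1 n" "b \<in> symbols m0 m1 n" for a b t
    using that by (simp add: gl_def)
  have mem: "a \<in> symbols m0 m1 n" "b \<in> symbols m0 m1 n"
    if "(a, b) \<in> Poly_Mapping.keys z" "z \<in> gl m0 m1 n" for a b z
    using that unfolding gl_def by blast+
  show ?thesis
    unfolding supercomm_def Let_def case_prod_beta
    apply (intro sum)
    subgoal for p q
      using mem[of "fst p" "snd p", OF _ assms(1)] mem[of "fst q" "snd q", OF _ assms(2)]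
      by (intro minus) (simp_all add: single zero)
    done
qed

subsection \<open>The tensor algebra\<close>

text \<open>
  The tensor algebra of a vector space with basis \<open>B\<close> is the free associative algebra on \<open>B\<close>,
  i.e. the algebra of the free monoid on \<open>B\<close>. Words get their own type, so that
  \<open>'g word \<Rightarrow>\<^sub>0 complex\<close> carries the convolution product of the library.
\<close>

datatype 'g word = Word (letters: "'g list")

instantiation word :: (type) monoid_add
begin

definition zero_word :: "'a word" where
  "0 = Word []"

definition plus_word :: "'a word \<Rightarrow> 'a word \<Rightarrow> 'a word" where
  "u + v = Word (letters u @ letters v)"

instance
  by standard (simp_all add: zero_word_def plus_word_def)

end

type_synonym tensor = "(symb \<times> symb) word \<Rightarrow>\<^sub>0 complex"

definition words :: "nat \<Rightarrow> nat \<Rightarrow> nat \<Rightarrow> (symb \<times> symb) word set" where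
  "words m0 m1 n = {w. set (letters w) \<subseteq> symbols m0 m1 n \<times> symbols m0 m1 n}"

definition tensor_algebra :: "nat \<Rightarrow> nat \<Rightarrow> nat \<Rightarrow> tensor ring" where
  "tensor_algebra m0 m1 n =
     \<lparr>carrier = {f. Poly_Mapping.keys f \<subseteq> words m0 m1 n},
      mult = (*), one = 1, zero = 0, add = (+)\<rparr>"

definition scalar :: "complex \<Rightarrow> tensor" where
  "scalar c = Poly_Mapping.single 0 c"

lemma tensor_algebra_simps:
  "f \<in> carrier (tensor_algebra m0 m1 n) \<longleftrightarrow> Poly_Mapping.keys f \<subseteq> words m0 m1 n"
  "f \<otimes>\<^bsub>tensor_algebra m0 m1 n\<^esub> g = f * g" "f \<oplus>\<^bsub>tensor_algebra m0 m1 n\<^esub> g = f + g"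
  "\<one>\<^bsub>tensor_algebra m0 m1 n\<^esub> = 1" "\<zero>\<^bsub>tensor_algebra m0 m1 n\<^esub> = 0"
  by (simp_all add: tensor_algebra_def)

lemma ring_tensor_algebra: "ring (tensor_algebra m0 m1 n)"
proof (rule ringI)
  let ?T = "tensor_algebra m0 m1 n"
  have add: "Poly_Mapping.keys (f + g) \<subseteq> words m0 m1 n"
    if "Poly_Mapping.keys f \<subseteq> words m0 m1 n" "Poly_Mapping.keys g \<subseteq> words m0 m1 n" for f g :: tensor
    using that Poly_Mapping.keys_add[of f g] by blast
  have words: "0 \<in> words m0 m1 n" "u \<in> words m0 m1 n \<Longrightarrow> v \<in> words m0 m1 n \<Longrightarrow> u + v \<in> words m0 m1 n" for u v
    by (simp_all add: words_def zero_word_def plus_word_def)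
  have mult: "Poly_Mapping.keys (f * g) \<subseteq> words m0 m1 n"
    if "Poly_Mapping.keys f \<subseteq> words m0 m1 n" "Poly_Mapping.keys g \<subseteq> words m0 m1 n" for f g :: tensor
    using that keys_mult[of f g] words(2) by blast
  show "abelian_group ?T"
  proof (rule abelian_groupI)
    fix f assume "f \<in> carrier ?T"
    then show "\<exists>g\<in>carrier ?T. g \<oplus>\<^bsub>?T\<^esub> f = \<zero>\<^bsub>?T\<^esub>"
      by (intro bexI[of _ "- f"]) (simp_all add: tensor_algebra_simps)
  qed (simp_all add: tensor_algebra_simps add ac_simps)
  show "Group.monoid ?T"
    by (rule monoidI) (simp_all add: tensor_algebra_simps mult words(1) mult.assoc)
qed (simp_all add: tensor_algebra_simps distrib_left distrib_right)

text \<open>The inclusion of the Lie superalgebra as the degree one part.\<close>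

definition incl :: "gl_elem \<Rightarrow> tensor" where
  "incl x = (\<Sum>p\<in>Poly_Mapping.keys x. Poly_Mapping.single (Word [p]) (Poly_Mapping.lookup x p))"

subsection \<open>The universal enveloping algebra\<close>

definition super_relations :: "nat \<Rightarrow> nat \<Rightarrow> nat \<Rightarrow> tensor set" where
  "super_relations m0 m1 n =
     {incl x * incl y - scalar ((-1) ^ (p * q)) * (incl y * incl x) - incl (supercomm x y) | x y p q.
        x \<in> gl m0 m1 n \<and> y \<in> gl m0 m1 n \<and> p \<in> {0, 1} \<and> q \<in> {0, 1} \<and>
        homogeneous p x \<and> homogeneous q y}"

lemma incl_elem: "incl (elem a b) = Poly_Mapping.single (Word [(a, b)]) 1"
  by (simp add: incl_def elem_def)

definition super_ideal :: "nat \<Rightarrow> nat \<Rightarrow> nat \<Rightarrow> tensor set" where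
  "super_ideal m0 m1 n = Idl\<^bsub>tensor_algebra m0 m1 n\<^esub> (super_relations m0 m1 n)"

definition U_gl :: "nat \<Rightarrow> nat \<Rightarrow> nat \<Rightarrow> tensor set ring" where
  "U_gl m0 m1 n = tensor_algebra m0 m1 n Quot super_ideal m0 m1 n"

lemma super_relations_closed: "super_relations m0 m1 n \<subseteq> carrier (tensor_algebra m0 m1 n)"
proof
  fix r assume "r \<in> super_relations m0 m1 n"
  then obtain x y p q where xy: "x \<in> gl m0 m1 n" "y \<in> gl m0 m1 n"
    and r: "r = incl x * incl y - scalar ((-1) ^ (p * q)) * (incl y * incl x) - incl (supercomm x y)"
    unfolding super_relations_def by blast
  let ?C = "carrier (tensor_algebra m0 m1 n)"
  interpret R: ring "tensor_algebra m0 m1 n" by (rule ring_tensor_algebra)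
  have minus: "f - g \<in> ?C" if "f \<in> ?C" "g \<in> ?C" for f g
    using that keys_diff[of f g] unfolding tensor_algebra_simps by blast
  have times: "f * g \<in> ?C" if "f \<in> ?C" "g \<in> ?C" for f g
    using R.m_closed[OF that] unfolding tensor_algebra_simps .
  have "incl z \<in> ?C" if z: "z \<in> gl m0 m1 n" for z
  proof -
    have "Poly_Mapping.keys (incl z) \<subseteq> (\<lambda>p. Word [p]) ` Poly_Mapping.keys z"
      unfolding incl_def by (rule order_trans[OF keys_sum]) (auto split: if_splits)
    moreover have "Word [p] \<in> words m0 m1 n" if "p \<in> Poly_Mapping.keys z" for p
      using subsetD[OF _ that, of "symbols m0 m1 n \<times> symbols m0 m1 n"] z
      by (simp add: gl_def words_def)
    ultimately show ?thesis
      unfolding tensor_algebra_simps by blast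
  qed
  moreover have "scalar c \<in> ?C" for c
    by (simp add: scalar_def tensor_algebra_simps words_def zero_word_def)
  ultimately show "r \<in> ?C"
    unfolding r by (intro minus times) (simp_all add: xy gl_supercomm)
qed

lemma ideal_super_ideal: "ideal (super_ideal m0 m1 n) (tensor_algebra m0 m1 n)"
  unfolding super_ideal_def
  by (rule ring.genideal_ideal[OF ring_tensor_algebra super_relations_closed])

lemma ring_U_gl: "ring (U_gl m0 m1 n)"
  unfolding U_gl_def by (rule ideal.quotient_is_ring[OF ideal_super_ideal])

text \<open>The image in the quotient of an element of the tensor algebra.\<close>

definition U_class :: "nat \<Rightarrow> nat \<Rightarrow> nat \<Rightarrow> tensor \<Rightarrow> tensor set" where
  "U_class m0 m1 n t = super_ideal m0 m1 n +>\<^bsub>tensor_algebra m0 m1 n\<^esub> t"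

definition U_smult :: "nat \<Rightarrow> nat \<Rightarrow> nat \<Rightarrow> complex \<Rightarrow> tensor set \<Rightarrow> tensor set" where
  "U_smult m0 m1 n c u = U_class m0 m1 n (scalar c) \<otimes>\<^bsub>U_gl m0 m1 n\<^esub> u"

definition U_elem :: "nat \<Rightarrow> nat \<Rightarrow> nat \<Rightarrow> symb \<Rightarrow> symb \<Rightarrow> tensor set" where
  "U_elem m0 m1 n a b = U_class m0 m1 n (incl (elem a b))"

text \<open>The adjoint action of an even element \<open>x\<close>: no sign occurs, whatever the parity of \<open>u\<close>.\<close>

definition ad :: "('u, 'm) ring_scheme \<Rightarrow> 'u \<Rightarrow> 'u \<Rightarrow> 'u" where
  "ad R x u = (x \<otimes>\<^bsub>R\<^esub> u) \<ominus>\<^bsub>R\<^esub> (u \<otimes>\<^bsub>R\<^esub> x)"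

text \<open>The product of a list of ring elements, in the order of the list.\<close>

definition list_prod :: "('u, 'm) ring_scheme \<Rightarrow> 'u list \<Rightarrow> 'u" where
  "list_prod R xs = foldr (\<lambda>x y. x \<otimes>\<^bsub>R\<^esub> y) xs \<one>\<^bsub>R\<^esub>"

text \<open>The \<open>n\<close>-tuples of nonnegative integers (zero entries allowed) with sum \<open>k\<close>; functions are
  extensional outside \<open>{1..n}\<close>, so that each tuple occurs exactly once.\<close>

definition weak_compositions :: "nat \<Rightarrow> nat \<Rightarrow> (nat \<Rightarrow> nat) set" where
  "weak_compositions n k = {h \<in> {1..n} \<rightarrow>\<^sub>E UNIV. (\<Sum>i\<in>{1..n}. h i) = k}"

end

theory Submission
  imports Defs
begin

text \<open>
  Write \<open>a\<^sub>r\<close> and \<open>b\<^sub>r\<close> for the images of \<open>e\<^sub>r\<^sub>\<beta>\<close> and \<open>e\<^sub>\<beta>\<^sub>r\<close>, and \<open>S\<^sub>k\<close> for the sum over the tuples of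
  weight \<open>k\<close>. All these generators are even, the \<open>a\<^sub>r\<close> commute with each other and so do the
  \<open>b\<^sub>r\<close>; multiplying the summand of \<open>h\<close> by \<open>a\<^sub>r\<close> on the left and \<open>b\<^sub>r\<close> on the right raises \<open>h\<^sub>r\<close> by one,
  which gives the recursion \<open>(k + 1) S\<^bsub>k+1\<^esub> = (\<Sum>r. a\<^sub>r S\<^sub>k b\<^sub>r)\<close>. Since \<open>[e\<^sub>i\<^sub>j, a\<^sub>r] = \<delta>\<^sub>j\<^sub>r a\<^sub>i\<close> and
  \<open>[e\<^sub>i\<^sub>j, b\<^sub>r] = - \<delta>\<^sub>i\<^sub>r b\<^sub>j\<close>, if \<open>e\<^sub>i\<^sub>j\<close> commutes with \<open>S\<^sub>k\<close> then its commutator with the right-hand side is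
  \<open>a\<^sub>i S\<^sub>k b\<^sub>j - a\<^sub>i S\<^sub>k b\<^sub>j = 0\<close>, and the claim follows by induction on \<open>k\<close>.
\<close>

section \<open>Finite sums and ordered products in a ring\<close>

lemma (in abelian_monoid) finsum_swap:
  assumes "finite A" "finite B" and "\<And>x y. x \<in> A \<Longrightarrow> y \<in> B \<Longrightarrow> f x y \<in> carrier G"
  shows "(\<Oplus>x\<in>A. \<Oplus>y\<in>B. f x y) = (\<Oplus>y\<in>B. \<Oplus>x\<in>A. f x y)"
  using assms(1,3)
proof (induction A rule: finite_induct)
  case empty
  then show ?case by simp
next
  case (insert x A)
  have "(\<Oplus>y\<in>B. f x y \<oplus> (\<Oplus>x\<in>A. f x y)) = (\<Oplus>y\<in>B. \<Oplus>x\<in>insert x A. f x y)"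
    using insert by (intro add.finprod_cong') (auto simp: Pi_def intro!: add.finprod_closed)
  moreover have "(\<Oplus>y\<in>B. f x y \<oplus> (\<Oplus>x\<in>A. f x y)) = (\<Oplus>y\<in>B. f x y) \<oplus> (\<Oplus>y\<in>B. \<Oplus>x\<in>A. f x y)"
    using insert by (intro add.finprod_multf) (auto simp: Pi_def intro!: add.finprod_closed)
  ultimately show ?case
    using insert by (simp add: Pi_def)
qed

lemma (in ring) list_prod_simps [simp]:
  "list_prod R [] = \<one>" "list_prod R (x # xs) = x \<otimes> list_prod R xs"
  by (simp_all add: list_prod_def)

lemma (in ring) list_prod_closed [simp]:
  "set xs \<subseteq> carrier R \<Longrightarrow> list_prod R xs \<in> carrier R"
  by (induction xs) auto

lemma (in ring) list_prod_commute:
  assumes "x \<in> carrier R" "set xs \<subseteq> carrier R" "\<And>y. y \<in> set xs \<Longrightarrow> x \<otimes> y = y \<otimes> x"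
  shows "x \<otimes> list_prod R xs = list_prod R xs \<otimes> x"
  using assms(2,3)
proof (induction xs)
  case Nil
  then show ?case using assms(1) by simp
next
  case (Cons y xs)
  have closed: "y \<in> carrier R" "list_prod R xs \<in> carrier R"
    using Cons.prems by auto
  have "x \<otimes> (y \<otimes> list_prod R xs) = y \<otimes> x \<otimes> list_prod R xs"
    using closed assms(1) Cons.prems(2)[of y] by (simp flip: m_assoc)
  also have "\<dots> = y \<otimes> (list_prod R xs \<otimes> x)"
    using closed assms(1) Cons by (simp add: m_assoc)
  finally show ?case
    using closed assms(1) by (simp add: m_assoc)
qed

text \<open>The extra factor arises at the place of \<open>r\<close> and moves to the right end past
  the later powers, as all factors commute. The order of \<open>xs\<close> is left free because it
  is descending for the \<open>a r\<close> and ascending for the \<open>b r\<close>.\<close>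

lemma (in ring) list_prod_pow_incr:
  fixes h :: "'i \<Rightarrow> nat"
  assumes "distinct xs" "r \<in> set xs" "\<And>q. q \<in> set xs \<Longrightarrow> a q \<in> carrier R"
    and comm: "\<And>q p. q \<in> set xs \<Longrightarrow> p \<in> set xs \<Longrightarrow> a q \<otimes> a p = a p \<otimes> a q"
  shows "list_prod R (map (\<lambda>q. a q [^] (h(r := Suc (h r))) q) xs)
    = list_prod R (map (\<lambda>q. a q [^] h q) xs) \<otimes> a r" (is "?P xs = ?Q xs \<otimes> _")
  using assms
proof (induction xs)
  case Nil
  then show ?case by simp
next
  case (Cons q xs)
  have Q: "?Q xs \<in> carrier R"
    using Cons.prems by (intro list_prod_closed) auto
  show ?case
  proof (cases "r = q")
    case True
    \<comment> \<open>By distinctness \<open>r\<close> does not recur in the tail, so the update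
      changes nothing there.\<close>
    have same: "map (\<lambda>q. a q [^] (h(r := Suc (h r))) q) xs = map (\<lambda>q. a q [^] h q) xs"
      using Cons.prems True by auto
    have "a r \<otimes> ?Q xs = ?Q xs \<otimes> a r"
      using Cons.prems True by (intro list_prod_commute) (auto simp: group_commutes_pow)
    moreover have "?P (q # xs) = a r [^] h r \<otimes> (a r \<otimes> ?P xs)"
      using Cons.prems True Q unfolding list.map same by (simp add: m_assoc)
    ultimately show ?thesis
      using Cons.prems True Q unfolding same by (simp add: m_assoc)
  next
    case False
    then show ?thesis
      using Cons Q by (simp add: m_assoc)
  qed
qed

section \<open>Tuples of given weight and their factorials\<close>

lemma finite_weak_compositions: "finite (weak_compositions n k)"
proof (rule finite_subset)
  show "weak_compositions n k \<subseteq> {1..n} \<rightarrow>\<^sub>E {..k}"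
  proof
    fix h assume h: "h \<in> weak_compositions n k"
    have "h i \<le> k" if "i \<in> {1..n}" for i
      using h member_le_sum[OF that, of h] by (simp add: weak_compositions_def)
    then show "h \<in> {1..n} \<rightarrow>\<^sub>E {..k}"
      using h by (auto simp: weak_compositions_def PiE_iff)
  qed
qed (simp add: finite_PiE)

lemma sum_fun_upd_Suc:
  fixes h :: "'i \<Rightarrow> nat"
  assumes "finite A" "r \<in> A"
  shows "sum (h(r := Suc (h r))) A = Suc (sum h A)"
  using assms by (simp add: sum.remove[of A r])

text \<open>The new factor \<open>Suc (h r)\<close> later turns the coefficient of a tuple into that
  of the raised tuple times its entry at \<open>r\<close>.\<close>

lemma prod_fact_fun_upd_Suc:
  fixes h :: "'i \<Rightarrow> nat"
  assumes "finite A" "r \<in> A"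
  shows "(\<Prod>q\<in>A. fact ((h(r := Suc (h r))) q)) =
    (of_nat (Suc (h r)) * (\<Prod>q\<in>A. fact (h q)) :: 'k::field_char_0)"
proof -
  have "(\<Prod>q\<in>A - {r}. fact ((h(r := Suc (h r))) q)) = (\<Prod>q\<in>A - {r}. fact (h q) :: 'k)"
    by (rule prod.cong) auto
  then show ?thesis
    unfolding prod.remove[OF assms] by (simp add: mult.assoc del: of_nat_Suc)
qed

text \<open>The inverse lowers the entry at \<open>r\<close>. Because subtraction truncates, raising
  it again recovers the tuple only where that entry is nonzero, hence the restricted target.\<close>

lemma bij_betw_weak_compositions_incr:
  assumes r: "r \<in> {1..n}"
  shows "bij_betw (\<lambda>h. h(r := Suc (h r))) (weak_compositions n k)
    {h \<in> weak_compositions n (Suc k). h r \<noteq> 0}"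
proof (rule bij_betwI[where g = "\<lambda>h. h(r := h r - 1)"])
  show "(\<lambda>h. h(r := Suc (h r))) \<in> weak_compositions n k \<rightarrow> {h \<in> weak_compositions n (Suc k). h r \<noteq> 0}"
    using r sum_fun_upd_Suc[of "{1..n}" r] by (auto simp: weak_compositions_def PiE_iff extensional_def)
  show "(\<lambda>h. h(r := h r - 1)) \<in> {h \<in> weak_compositions n (Suc k). h r \<noteq> 0} \<rightarrow> weak_compositions n k"
  proof
    fix h assume h: "h \<in> {h \<in> weak_compositions n (Suc k). h r \<noteq> 0}"
    \<comment> \<open>Recognising \<open>h\<close> as a raised tuple gives the weight of the lowered
      one by cancelling \<open>Suc\<close>.\<close>
    have up: "(h(r := h r - 1))(r := Suc ((h(r := h r - 1)) r)) = h"
      using h by auto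
    have "(\<Sum>i\<in>{1..n}. (h(r := h r - 1)) i) = k"
      using sum_fun_upd_Suc[of "{1..n}" r "h(r := h r - 1)"] h r unfolding up
      by (simp add: weak_compositions_def del: fun_upd_apply)
    then show "h(r := h r - 1) \<in> weak_compositions n k"
      using h r by (auto simp: weak_compositions_def PiE_iff extensional_def)
  qed
qed auto

section \<open>The sums \<open>S_k\<close> in a ring with central scalars\<close>

text \<open>An algebra over a field of characteristic zero, given by a unital homomorphism
  \<open>s\<close> from the field into the centre of the ring.\<close>

locale central_scalars = ring R for R (structure) +
  fixes s :: "'k::field_char_0 \<Rightarrow> 'a"
  assumes s_closed [simp]: "s c \<in> carrier R"
    and s_one [simp]: "s 1 = \<one>"
    and s_add: "s (c + d) = s c \<oplus> s d"
    and s_mult: "s (c * d) = s c \<otimes> s d"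
    and s_central: "x \<in> carrier R \<Longrightarrow> s c \<otimes> x = x \<otimes> s c"
begin

lemma s_zero [simp]: "s 0 = \<zero>"
  using s_add[of 0 0] by simp

lemma s_sum: "finite A \<Longrightarrow> s (sum f A) = (\<Oplus>x\<in>A. s (f x))"
  by (induction A rule: finite_induct) (simp_all add: s_add)

lemma s_left_commute:
  "x \<in> carrier R \<Longrightarrow> y \<in> carrier R \<Longrightarrow> x \<otimes> (s c \<otimes> y) = s c \<otimes> (x \<otimes> y)"
  by (simp add: s_central[of x] flip: m_assoc)

lemma s_inverse_cancel: "c \<noteq> 0 \<Longrightarrow> x \<in> carrier R \<Longrightarrow> s (1 / c) \<otimes> (s c \<otimes> x) = x"
  by (simp flip: m_assoc s_mult)

definition capelli_term :: "(nat \<Rightarrow> 'a) \<Rightarrow> (nat \<Rightarrow> 'a) \<Rightarrow> nat \<Rightarrow> (nat \<Rightarrow> nat) \<Rightarrow> 'a" where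
  "capelli_term a b n h =
     list_prod R (map (\<lambda>r. a r [^] h r) (rev [1..<n+1])) \<otimes> list_prod R (map (\<lambda>r. b r [^] h r) [1..<n+1])"

text \<open>For commuting families this is the normally ordered k-th divided power of the sum of the
  \<open>a r \<otimes> b r\<close>: all \<open>a\<close> stand to the left of all
  \<open>b\<close>.\<close>

definition capelli_sum :: "(nat \<Rightarrow> 'a) \<Rightarrow> (nat \<Rightarrow> 'a) \<Rightarrow> nat \<Rightarrow> nat \<Rightarrow> 'a" where
  "capelli_sum a b n k =
     (\<Oplus>h\<in>weak_compositions n k. s (1 / (\<Prod>r\<in>{1..n}. fact (h r))) \<otimes> capelli_term a b n h)"

context
  fixes a b :: "nat \<Rightarrow> 'a" and n :: nat
  assumes a_closed: "\<And>r. r \<in> {1..n} \<Longrightarrow> a r \<in> carrier R"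
    and b_closed: "\<And>r. r \<in> {1..n} \<Longrightarrow> b r \<in> carrier R"
    and a_commute: "\<And>r q. r \<in> {1..n} \<Longrightarrow> q \<in> {1..n} \<Longrightarrow> a r \<otimes> a q = a q \<otimes> a r"
    and b_commute: "\<And>r q. r \<in> {1..n} \<Longrightarrow> q \<in> {1..n} \<Longrightarrow> b r \<otimes> b q = b q \<otimes> b r"
begin

lemma powers_closed:
  "list_prod R (map (\<lambda>r. a r [^] (h r::nat)) (rev [1..<n+1])) \<in> carrier R"
  "list_prod R (map (\<lambda>r. b r [^] (h r::nat)) [1..<n+1]) \<in> carrier R"
  using a_closed b_closed by (auto simp del: upt_Suc intro!: list_prod_closed)

lemma capelli_term_closed [simp]: "capelli_term a b n h \<in> carrier R"
  unfolding capelli_term_def by (intro m_closed powers_closed)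

lemma capelli_sum_closed [simp]: "capelli_sum a b n k \<in> carrier R"
  unfolding capelli_sum_def by (intro finsum_closed) simp

lemma capelli_term_incr:
  assumes r: "r \<in> {1..n}"
  shows "a r \<otimes> capelli_term a b n h \<otimes> b r = capelli_term a b n (h(r := Suc (h r)))"
proof -
  let ?A = "\<lambda>h. list_prod R (map (\<lambda>r. a r [^] (h r::nat)) (rev [1..<n+1]))"
  let ?B = "\<lambda>h. list_prod R (map (\<lambda>r. b r [^] (h r::nat)) [1..<n+1])"
  have "?A (h(r := Suc (h r))) = ?A h \<otimes> a r"
    using r by (intro list_prod_pow_incr a_closed a_commute) auto
  \<comment> \<open>The new factor lands at the right end of the \<open>a\<close> product, next to
    the \<open>b\<close> product, and has to be carried across to the left end.\<close>
  also have "\<dots> = a r \<otimes> ?A h"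
    using r a_closed a_commute
    by (intro list_prod_commute[symmetric]) (auto simp: group_commutes_pow)
  finally have A: "?A (h(r := Suc (h r))) = a r \<otimes> ?A h" .
  have B: "?B (h(r := Suc (h r))) = ?B h \<otimes> b r"
    using r by (intro list_prod_pow_incr b_closed b_commute) auto
  show ?thesis
    unfolding capelli_term_def A B
    using powers_closed[of h] a_closed[OF r] b_closed[OF r] by (simp only: m_assoc m_closed)
qed

text \<open>In terms of the raised tuple the coefficient acquires the entry at \<open>r\<close> as
  numerator. Tuples with entry zero at \<open>r\<close> then count zero, so the index set can be
  chosen independent of \<open>r\<close>, as the later exchange of sums requires.\<close>

lemma sandwich_capelli_sum:
  assumes r: "r \<in> {1..n}"
  shows "a r \<otimes> capelli_sum a b n k \<otimes> b r
    = (\<Oplus>h\<in>weak_compositions n (Suc k).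
        s (of_nat (h r) / (\<Prod>q\<in>{1..n}. fact (h q))) \<otimes> capelli_term a b n h)" (is "_ = (\<Oplus>h\<in>_. ?F h)")
proof -
  let ?up = "\<lambda>h. h(r := Suc (h r))"
  let ?W = "{h \<in> weak_compositions n (Suc k). h r \<noteq> 0}"
  have fact: "of_nat (Suc (h r)) / (\<Prod>q\<in>{1..n}. fact (?up h q)) = (1 / (\<Prod>q\<in>{1..n}. fact (h q)) :: 'k)" for h
    using r by (subst prod_fact_fun_upd_Suc) (simp_all del: of_nat_Suc fun_upd_apply)
  have "a r \<otimes> capelli_sum a b n k \<otimes> b r
    = (\<Oplus>h\<in>weak_compositions n k.
        a r \<otimes> (s (1 / (\<Prod>q\<in>{1..n}. fact (h q))) \<otimes> capelli_term a b n h) \<otimes> b r)"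
    unfolding capelli_sum_def
    using a_closed[OF r] b_closed[OF r]
    by (simp add: finsum_rdistr finsum_ldistr finite_weak_compositions Pi_def)
  also have "\<dots> = (\<Oplus>h\<in>weak_compositions n k. ?F (?up h))"
  proof (rule finsum_cong')
    fix h
    have "a r \<otimes> (s (1 / (\<Prod>q\<in>{1..n}. fact (h q))) \<otimes> capelli_term a b n h) \<otimes> b r
      = s (1 / (\<Prod>q\<in>{1..n}. fact (h q))) \<otimes> (a r \<otimes> capelli_term a b n h \<otimes> b r)"
      using a_closed[OF r] b_closed[OF r] by (simp add: s_left_commute m_assoc)
    then show "a r \<otimes> (s (1 / (\<Prod>q\<in>{1..n}. fact (h q))) \<otimes> capelli_term a b n h) \<otimes> b r = ?F (?up h)"
      unfolding capelli_term_incr[OF r] using fact[of h] by simp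
  qed (auto simp: Pi_def)
  also have "\<dots> = (\<Oplus>h\<in>?W. ?F h)"
    using finsum_reindex[of ?F ?up "weak_compositions n k"] bij_betw_weak_compositions_incr[OF r, of k]
    by (auto simp: bij_betw_def Pi_def)
  \<comment> \<open>The added tuples have \<open>h r = 0\<close>, hence coefficient zero.\<close>
  also have "\<dots> = (\<Oplus>h\<in>weak_compositions n (Suc k). ?F h)"
    by (rule add.finprod_mono_neutral_cong_left) (auto simp: finite_weak_compositions Pi_def)
  finally show ?thesis .
qed

text \<open>After the two sums are exchanged, each tuple collects the numerators \<open>h r\<close>,
  whose total is its weight \<open>Suc k\<close>.\<close>

lemma capelli_sum_Suc:
  "s (of_nat (Suc k)) \<otimes> capelli_sum a b n (Suc k) = (\<Oplus>r\<in>{1..n}. a r \<otimes> capelli_sum a b n k \<otimes> b r)"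
proof -
  let ?c = "\<lambda>h. \<Prod>q\<in>{1..n}. fact (h q) :: 'k"
  let ?W = "weak_compositions n (Suc k)"
  have "(\<Oplus>r\<in>{1..n}. a r \<otimes> capelli_sum a b n k \<otimes> b r)
    = (\<Oplus>r\<in>{1..n}. \<Oplus>h\<in>?W. s (of_nat (h r) / ?c h) \<otimes> capelli_term a b n h)"
    by (intro finsum_cong' sandwich_capelli_sum) (auto simp: Pi_def intro!: finsum_closed)
  also have "\<dots> = (\<Oplus>h\<in>?W. \<Oplus>r\<in>{1..n}. s (of_nat (h r) / ?c h) \<otimes> capelli_term a b n h)"
    by (rule finsum_swap) (auto simp: finite_weak_compositions)
  also have "\<dots> = (\<Oplus>h\<in>?W. s (of_nat (Suc k)) \<otimes> (s (1 / ?c h) \<otimes> capelli_term a b n h))"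
  proof (rule finsum_cong')
    fix h assume h: "h \<in> ?W"
    have "(\<Oplus>r\<in>{1..n}. s (of_nat (h r) / ?c h) \<otimes> capelli_term a b n h)
      = s (\<Sum>r\<in>{1..n}. of_nat (h r) / ?c h) \<otimes> capelli_term a b n h"
      by (simp add: s_sum finsum_ldistr Pi_def)
    also have "(\<Sum>r\<in>{1..n}. of_nat (h r) / ?c h) = of_nat (\<Sum>r\<in>{1..n}. h r) * (1 / ?c h)"
      by (simp flip: sum_divide_distrib)
    also have "(\<Sum>r\<in>{1..n}. h r) = Suc k"
      using h by (simp add: weak_compositions_def)
    finally show "(\<Oplus>r\<in>{1..n}. s (of_nat (h r) / ?c h) \<otimes> capelli_term a b n h)
      = s (of_nat (Suc k)) \<otimes> (s (1 / ?c h) \<otimes> capelli_term a b n h)"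
      by (simp only: s_mult m_assoc s_closed capelli_term_closed)
  qed (auto simp: Pi_def)
  also have "\<dots> = s (of_nat (Suc k)) \<otimes> capelli_sum a b n (Suc k)"
    unfolding capelli_sum_def by (rule finsum_rdistr[symmetric]) (auto simp: finite_weak_compositions)
  finally show ?thesis ..
qed

text \<open>Each commutator of \<open>E\<close> is stated with its correction on the side where it
  is positive, so that no subtraction enters. The corrections coming from \<open>a j\<close> and
  \<open>b i\<close> are both \<open>a i S_k b j\<close>, with opposite signs.\<close>

lemma commute_capelli_sum:
  assumes E: "E \<in> carrier R" and ij: "i \<in> {1..n}" "j \<in> {1..n}"
    and Ea: "\<And>r. r \<in> {1..n} \<Longrightarrow> E \<otimes> a r = a r \<otimes> E \<oplus> (if r = j then a i else \<zero>)"
    and Eb: "\<And>r. r \<in> {1..n} \<Longrightarrow> E \<otimes> b r \<oplus> (if r = i then b j else \<zero>) = b r \<otimes> E"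
  shows "E \<otimes> capelli_sum a b n k = capelli_sum a b n k \<otimes> E"
proof (induction k)
  case 0
  have W: "weak_compositions n 0 = {\<lambda>r\<in>{1..n}. 0}"
    by (auto simp: weak_compositions_def PiE_iff extensional_def restrict_def fun_eq_iff)
  \<comment> \<open>Unfolding the zero tuple leaves \<open>undefined\<close> outside
    \<open>{1..n}\<close>; the indices in the list stay inside, so every factor is a zeroth
    power.\<close>
  have "list_prod R (map (\<lambda>r. x r [^] (if 1 \<le> r \<and> r \<le> n then 0 else undefined::nat)) xs) = \<one>"
    if "set xs \<subseteq> {1..n}" for x :: "nat \<Rightarrow> 'a" and xs
    using that by (induction xs) auto
  then have "capelli_sum a b n 0 = \<one>"
    unfolding capelli_sum_def W by (simp add: capelli_term_def restrict_def subset_iff del: upt_Suc)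
  then show ?case using E by simp
next
  case (Suc k)
  let ?S = "capelli_sum a b n k" and ?T = "capelli_sum a b n (Suc k)" and ?c = "of_nat (Suc k) :: 'k"
  let ?\<Sigma> = "\<Oplus>r\<in>{1..n}. a r \<otimes> ?S \<otimes> b r"
  note closed = E a_closed b_closed capelli_sum_closed
  have \<Sigma>: "?\<Sigma> \<in> carrier R"
    using closed by (intro finsum_closed) (auto simp: Pi_def)
  \<comment> \<open>\<open>E\<close> travels to the right past \<open>a r\<close>, past
    \<open>?S\<close> by the induction hypothesis, and past \<open>b r\<close>. For a single
    \<open>r\<close> the two corrections need not agree.\<close>
  have move: "E \<otimes> (a r \<otimes> ?S \<otimes> b r) \<oplus> (if r = i then a i \<otimes> ?S \<otimes> b j else \<zero>)
      = (a r \<otimes> ?S \<otimes> b r) \<otimes> E \<oplus> (if r = j then a i \<otimes> ?S \<otimes> b j else \<zero>)" if r: "r \<in> {1..n}" for r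
  proof -
    have "E \<otimes> (a r \<otimes> ?S \<otimes> b r) = (E \<otimes> a r) \<otimes> ?S \<otimes> b r"
      using r closed by (simp add: m_assoc)
    also have "\<dots> = a r \<otimes> (E \<otimes> ?S) \<otimes> b r \<oplus> (if r = j then a i \<otimes> ?S \<otimes> b j else \<zero>)"
      using r ij closed by (simp add: Ea l_distr m_assoc)
    also have "\<dots> = a r \<otimes> ?S \<otimes> (E \<otimes> b r) \<oplus> (if r = j then a i \<otimes> ?S \<otimes> b j else \<zero>)"
      using r closed by (simp add: Suc m_assoc)
    finally have "E \<otimes> (a r \<otimes> ?S \<otimes> b r) \<oplus> (if r = i then a i \<otimes> ?S \<otimes> b j else \<zero>)
      = a r \<otimes> ?S \<otimes> (E \<otimes> b r \<oplus> (if r = i then b j else \<zero>)) \<oplus> (if r = j then a i \<otimes> ?S \<otimes> b j else \<zero>)"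
      using r ij closed by (simp add: r_distr a_ac)
    then show ?thesis
      using r closed by (simp add: Eb m_assoc)
  qed
  have single: "(\<Oplus>r\<in>A. if r = q then x else \<zero>) = x"
    if "finite A" "q \<in> A" "x \<in> carrier R" for A x and q :: nat
    using add.finprod_singleton_swap[of q A "\<lambda>_. x"] that by simp
  \<comment> \<open>Each delta selects one index, \<open>i\<close> on the left and \<open>j\<close>
    on the right, so both sides keep the same extra summand, which then cancels.\<close>
  have "E \<otimes> ?\<Sigma> \<oplus> a i \<otimes> ?S \<otimes> b j
    = (\<Oplus>r\<in>{1..n}. E \<otimes> (a r \<otimes> ?S \<otimes> b r) \<oplus> (if r = i then a i \<otimes> ?S \<otimes> b j else \<zero>))"
    using ij closed by (subst finsum_addf) (auto simp: single finsum_rdistr Pi_def)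
  also have "\<dots> = (\<Oplus>r\<in>{1..n}. (a r \<otimes> ?S \<otimes> b r) \<otimes> E \<oplus> (if r = j then a i \<otimes> ?S \<otimes> b j else \<zero>))"
    using ij closed by (intro finsum_cong' move) (auto simp: Pi_def)
  also have "\<dots> = ?\<Sigma> \<otimes> E \<oplus> a i \<otimes> ?S \<otimes> b j"
    using ij closed by (subst finsum_addf) (auto simp: single finsum_ldistr Pi_def)
  finally have "E \<otimes> ?\<Sigma> = ?\<Sigma> \<otimes> E"
    using ij closed \<Sigma> by simp
  \<comment> \<open>The factor \<open>Suc k\<close> of the recursion is central and invertible in
    characteristic zero, so it can be removed.\<close>
  then have "E \<otimes> (s ?c \<otimes> ?T) = (s ?c \<otimes> ?T) \<otimes> E"
    by (simp only: capelli_sum_Suc)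
  then have "s ?c \<otimes> (E \<otimes> ?T) = s ?c \<otimes> (?T \<otimes> E)"
    using E s_left_commute[of E ?T ?c] m_assoc[of "s ?c" ?T E] by simp
  then have "s (1 / ?c) \<otimes> (s ?c \<otimes> (E \<otimes> ?T)) = s (1 / ?c) \<otimes> (s ?c \<otimes> (?T \<otimes> E))"
    by (rule arg_cong)
  moreover have "?c \<noteq> 0"
    by (simp del: of_nat_Suc)
  ultimately show ?case
    using E by (simp add: s_inverse_cancel del: of_nat_Suc)
qed

end

end

section \<open>The enveloping algebra as a ring with central scalars\<close>

lemma U_class_ring_hom: "U_class m0 m1 n \<in> ring_hom (tensor_algebra m0 m1 n) (U_gl m0 m1 n)"
  using ideal.rcos_ring_hom[OF ideal_super_ideal, of m0 m1 n]
  unfolding U_gl_def U_class_def[abs_def] .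

lemma scalar_closed: "scalar c \<in> carrier (tensor_algebra m0 m1 n)"
  by (simp add: scalar_def tensor_algebra_simps words_def zero_word_def)

lemma poly_mapping_sum_single:
  "(\<Sum>w\<in>Poly_Mapping.keys f. Poly_Mapping.single w (Poly_Mapping.lookup f w)) = f"
  by (rule poly_mapping_eqI) (auto simp: lookup_sum lookup_single when_def in_keys_iff)

text \<open>A scalar is supported on the empty word, which is neutral for concatenation on both
  sides, so it commutes with monomials and by linearity with everything.\<close>

lemma scalar_central: "scalar c * f = f * scalar c"
proof -
  have "scalar c * Poly_Mapping.single w d = Poly_Mapping.single w d * scalar c" for w d
    by (simp add: scalar_def mult_single mult.commute)
  then have "scalar c * (\<Sum>w\<in>Poly_Mapping.keys f. Poly_Mapping.single w (Poly_Mapping.lookup f w))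
    = (\<Sum>w\<in>Poly_Mapping.keys f. Poly_Mapping.single w (Poly_Mapping.lookup f w)) * scalar c"
    by (simp add: sum_distrib_left sum_distrib_right)
  then show ?thesis
    by (simp only: poly_mapping_sum_single)
qed

lemma U_gl_carrierE:
  assumes "u \<in> carrier (U_gl m0 m1 n)"
  obtains t where "t \<in> carrier (tensor_algebra m0 m1 n)" "u = U_class m0 m1 n t"
  using assms unfolding U_gl_def U_class_def FactRing_def A_RCOSETS_def' by auto

text \<open>Centrality descends from the tensor algebra because every element of the quotient is a
  class.\<close>

lemma central_scalars_U_gl: "central_scalars (U_gl m0 m1 n) (\<lambda>c. U_class m0 m1 n (scalar c))"
proof -
  let ?T = "tensor_algebra m0 m1 n"
  interpret U: ring "U_gl m0 m1 n" by (rule ring_U_gl)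
  note hom = U_class_ring_hom[of m0 m1 n]
  note add = ring_hom_add[OF hom, unfolded tensor_algebra_simps(3)]
  note mult = ring_hom_mult[OF hom, unfolded tensor_algebra_simps(2)]
  show ?thesis
  proof
    fix c d :: complex
    show "U_class m0 m1 n (scalar c) \<in> carrier (U_gl m0 m1 n)"
      by (rule ring_hom_closed[OF hom scalar_closed])
    show "U_class m0 m1 n (scalar 1) = \<one>\<^bsub>U_gl m0 m1 n\<^esub>"
      using ring_hom_one[OF hom] by (simp add: scalar_def tensor_algebra_simps)
    show "U_class m0 m1 n (scalar (c + d)) =
        U_class m0 m1 n (scalar c) \<oplus>\<^bsub>U_gl m0 m1 n\<^esub> U_class m0 m1 n (scalar d)"
      using add[OF scalar_closed scalar_closed, of c d] by (simp add: scalar_def single_add)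
    show "U_class m0 m1 n (scalar (c * d)) =
        U_class m0 m1 n (scalar c) \<otimes>\<^bsub>U_gl m0 m1 n\<^esub> U_class m0 m1 n (scalar d)"
      using mult[OF scalar_closed scalar_closed, of c d] by (simp add: scalar_def mult_single)
  next
    fix u and c :: complex assume "u \<in> carrier (U_gl m0 m1 n)"
    then obtain t where t: "t \<in> carrier ?T" "u = U_class m0 m1 n t"
      by (rule U_gl_carrierE)
    show "U_class m0 m1 n (scalar c) \<otimes>\<^bsub>U_gl m0 m1 n\<^esub> u = u \<otimes>\<^bsub>U_gl m0 m1 n\<^esub> U_class m0 m1 n (scalar c)"
      using mult[OF scalar_closed t(1), of c] mult[OF t(1) scalar_closed, of c]
      by (simp add: t(2) scalar_central)
  qed
qed

section \<open>Generators of the enveloping algebra and their commutation\<close>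

lemma incl_elem_closed:
  assumes "a \<in> symbols m0 m1 n" "b \<in> symbols m0 m1 n"
  shows "incl (elem a b) \<in> carrier (tensor_algebra m0 m1 n)"
  using assms by (simp add: incl_elem tensor_algebra_simps words_def)

lemma U_elem_closed:
  assumes "a \<in> symbols m0 m1 n" "b \<in> symbols m0 m1 n"
  shows "U_elem m0 m1 n a b \<in> carrier (U_gl m0 m1 n)"
  unfolding U_elem_def by (rule ring_hom_closed[OF U_class_ring_hom incl_elem_closed[OF assms]])

lemma incl_zero [simp]: "incl 0 = 0"
  by (simp add: incl_def)

text \<open>The range of the sum in \<open>incl\<close> depends on its argument; a common finite
  range lets \<open>incl\<close> of a difference be compared termwise.\<close>

lemma incl_superset:
  assumes "finite A" "Poly_Mapping.keys x \<subseteq> A"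
  shows "incl x = (\<Sum>p\<in>A. Poly_Mapping.single (Word [p]) (Poly_Mapping.lookup x p))"
  unfolding incl_def using assms by (intro sum.mono_neutral_left) (auto simp: in_keys_iff)

lemma incl_diff: "incl (x - y) = incl x - incl y"
proof -
  let ?A = "Poly_Mapping.keys x \<union> Poly_Mapping.keys y"
  have "incl z = (\<Sum>p\<in>?A. Poly_Mapping.single (Word [p]) (Poly_Mapping.lookup z p))"
    if "Poly_Mapping.keys z \<subseteq> ?A" for z
    using that by (intro incl_superset) auto
  then show ?thesis
    using keys_diff[of x y] by (simp add: lookup_minus single_diff sum_subtractf)
qed

text \<open>With all four symbols odd, both generators are even and the defining relation is an
  ordinary commutator. Its delta terms are put on opposite sides to match the hypotheses of
  \<open>commute_capelli_sum\<close>.\<close>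

lemma U_elem_commutation:
  assumes sym: "{a, b, c, d} \<subseteq> symbols m0 m1 n"
    and odd: "parity a = 1" "parity b = 1" "parity c = 1" "parity d = 1"
  defines "U \<equiv> U_gl m0 m1 n" and "e \<equiv> U_elem m0 m1 n"
  shows "e a b \<otimes>\<^bsub>U\<^esub> e c d \<oplus>\<^bsub>U\<^esub> (if a = d then e c b else \<zero>\<^bsub>U\<^esub>)
    = e c d \<otimes>\<^bsub>U\<^esub> e a b \<oplus>\<^bsub>U\<^esub> (if b = c then e a d else \<zero>\<^bsub>U\<^esub>)"
proof -
  let ?T = "tensor_algebra m0 m1 n" and ?I = "super_ideal m0 m1 n" and ?C = "U_class m0 m1 n"
  let ?x = "incl (elem a b)" and ?y = "incl (elem c d)"
  let ?p = "if a = d then incl (elem c b) else 0" and ?q = "if b = c then incl (elem a d) else 0"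
  interpret T: ring ?T by (rule ring_tensor_algebra)
  have closed: "?x \<in> carrier ?T" "?y \<in> carrier ?T" "?p \<in> carrier ?T" "?q \<in> carrier ?T"
    using sym incl_elem_closed T.zero_closed by (auto simp: tensor_algebra_simps(5))
  \<comment> \<open>The sign has exponent \<open>(1 + 1) * (1 + 1)\<close>, which is even.\<close>
  have comm: "supercomm (elem a b) (elem c d) =
      (if b = c then elem a d else 0) - (if a = d then elem c b else 0)"
    by (simp add: supercomm_elem odd) (simp add: elem_def)
  have in_gl: "elem u v \<in> gl m0 m1 n" if "u \<in> symbols m0 m1 n" "v \<in> symbols m0 m1 n" for u v
    using that by (simp add: gl_def elem_def)
  have hom: "homogeneous 0 (elem a b)" "homogeneous 0 (elem c d)"
    by (simp_all add: homogeneous_def elem_def odd)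
  have "?x * ?y - ?y * ?x - (?q - ?p) \<in> super_relations m0 m1 n"
    unfolding super_relations_def
    apply (rule CollectI)
    apply (rule exI[of _ "elem a b"], rule exI[of _ "elem c d"], rule exI[of _ 0], rule exI[of _ 0])
    using sym in_gl hom by (simp add: comm incl_diff if_distrib[of incl] scalar_def)
  then have "?x * ?y - ?y * ?x - (?q - ?p) \<in> ?I"
    using T.genideal_self[OF super_relations_closed] unfolding super_ideal_def by blast
  then have I: "(?x * ?y + ?p) - (?y * ?x + ?q) \<in> ?I"
    by (simp add: algebra_simps)
  \<comment> \<open>The coset criterion uses the subtraction of the ring record, the relation above
    that of the type; on the carrier they agree.\<close>
  have minus: "f \<ominus>\<^bsub>?T\<^esub> g = f - g" if "f \<in> carrier ?T" "g \<in> carrier ?T" for f g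
  proof -
    have "\<ominus>\<^bsub>?T\<^esub> g = - g"
      using that by (intro T.minus_equality) (simp_all add: tensor_algebra_simps)
    then show ?thesis by (simp add: a_minus_def tensor_algebra_simps)
  qed
  have lhs: "?x * ?y + ?p \<in> carrier ?T" and rhs: "?y * ?x + ?q \<in> carrier ?T"
    using closed T.m_closed T.a_closed unfolding tensor_algebra_simps(2,3) by blast+
  have "?C (?x * ?y + ?p) = ?C (?y * ?x + ?q)"
    using I T.quotient_eq_iff_same_a_r_cos[OF ideal_super_ideal lhs rhs]
    unfolding minus[OF lhs rhs] U_class_def by blast
  moreover note hom = U_class_ring_hom[of m0 m1 n]
  note hom_simps = ring_hom_mult[OF hom, unfolded tensor_algebra_simps(2)]
    ring_hom_add[OF hom, unfolded tensor_algebra_simps(3)]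
  have mult: "?x * ?y \<in> carrier ?T" "?y * ?x \<in> carrier ?T"
    using closed T.m_closed unfolding tensor_algebra_simps(2) by blast+
  have zero: "?C 0 = \<zero>\<^bsub>U\<^esub>"
    using ring_hom_zero[OF hom T.ring_axioms ring_U_gl] by (simp add: U_def tensor_algebra_simps)
  ultimately show ?thesis
    using closed mult
    by (simp only: hom_simps U_def[symmetric] e_def U_elem_def zero if_distrib[of ?C])
qed

theorem proposition4p23:
  fixes m0 m1 n k i j :: nat
  fixes e :: "symb \<Rightarrow> symb \<Rightarrow> tensor set" and U :: "tensor set ring"
  defines "U \<equiv> U_gl m0 m1 n"
    and "e \<equiv> U_elem m0 m1 n"
  assumes "m1 \<ge> 1" and "n \<ge> 1" and "k \<ge> 1"
    and "\<beta> \<in> Beta ` {1..m1}"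
    and "i \<in> {1..n}" and "j \<in> {1..n}"
  shows "ad U (e (Prop i) (Prop j))
      (\<Oplus>\<^bsub>U\<^esub>h\<in>weak_compositions n k.
         U_smult m0 m1 n (1 / (\<Prod>r\<in>{1..n}. fact (h r)))
           (list_prod U (map (\<lambda>r. e (Prop r) \<beta> [^]\<^bsub>U\<^esub> h r) (rev [1..<n+1]))
            \<otimes>\<^bsub>U\<^esub> list_prod U (map (\<lambda>r. e \<beta> (Prop r) [^]\<^bsub>U\<^esub> h r) [1..<n+1])))
    = \<zero>\<^bsub>U\<^esub>"
proof -
  interpret U: central_scalars U "\<lambda>c. U_class m0 m1 n (scalar c)"
    unfolding U_def by (rule central_scalars_U_gl)
  define a where "a r = e (Prop r) \<beta>" for r
  define b where "b r = e \<beta> (Prop r)" for r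
  \<comment> \<open>Since \<open>\<beta>\<close> differs from all proper symbols, every delta
    between the two kinds vanishes.\<close>
  have beta: "\<beta> \<in> symbols m0 m1 n" "parity \<beta> = 1" "\<beta> \<noteq> Prop r" "Prop r \<noteq> \<beta>" for r
    using assms(6) by (auto simp: symbols_def)
  have proper: "Prop r \<in> symbols m0 m1 n" if "r \<in> {1..n}" for r
    using that by (auto simp: symbols_def)
  have closed: "e x y \<in> carrier U" if "x \<in> symbols m0 m1 n" "y \<in> symbols m0 m1 n" for x y
    unfolding e_def U_def using that by (rule U_elem_closed)
  note commutation = U_elem_commutation[of _ _ _ _ m0 m1 n, folded U_def e_def]
  let ?E = "e (Prop i) (Prop j)"
  have ab: "a r \<in> carrier U" "b r \<in> carrier U" if "r \<in> {1..n}" for r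
    unfolding a_def b_def using that beta proper closed by blast+
  have E: "?E \<in> carrier U"
    using proper closed assms by blast
  have aa: "a r \<otimes>\<^bsub>U\<^esub> a q = a q \<otimes>\<^bsub>U\<^esub> a r" if "r \<in> {1..n}" "q \<in> {1..n}" for r q
    using commutation[of "Prop r" \<beta> "Prop q" \<beta>] ab that by (simp add: a_def beta proper)
  have bb: "b r \<otimes>\<^bsub>U\<^esub> b q = b q \<otimes>\<^bsub>U\<^esub> b r" if "r \<in> {1..n}" "q \<in> {1..n}" for r q
    using commutation[of \<beta> "Prop r" \<beta> "Prop q"] ab that by (simp add: b_def beta proper)
  have "?E \<otimes>\<^bsub>U\<^esub> U.capelli_sum a b n k = U.capelli_sum a b n k \<otimes>\<^bsub>U\<^esub> ?E"
  proof (rule U.commute_capelli_sum[OF ab aa bb E assms(7,8)])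
    \<comment> \<open>One delta survives in each case: \<open>r = j\<close> for \<open>a r\<close>
      and \<open>r = i\<close> for \<open>b r\<close>.\<close>
    fix r assume r: "r \<in> {1..n}"
    show "?E \<otimes>\<^bsub>U\<^esub> a r = a r \<otimes>\<^bsub>U\<^esub> ?E \<oplus>\<^bsub>U\<^esub> (if r = j then a i else \<zero>\<^bsub>U\<^esub>)"
      using commutation[of "Prop i" "Prop j" "Prop r" \<beta>] ab[OF r] r E assms(7,8)
      unfolding a_def by (simp add: beta proper eq_commute[of j] split del: if_split)
    show "?E \<otimes>\<^bsub>U\<^esub> b r \<oplus>\<^bsub>U\<^esub> (if r = i then b j else \<zero>\<^bsub>U\<^esub>) = b r \<otimes>\<^bsub>U\<^esub> ?E"
      using commutation[of "Prop i" "Prop j" \<beta> "Prop r"] ab[OF r] r E assms(7,8)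
      unfolding b_def by (simp add: beta proper eq_commute[of i] split del: if_split)
  qed
  moreover have "U.capelli_sum a b n k \<in> carrier U"
    by (rule U.capelli_sum_closed[OF ab aa bb])
  ultimately have "ad U ?E (U.capelli_sum a b n k) = \<zero>\<^bsub>U\<^esub>"
    unfolding ad_def using E by (simp add: a_minus_def U.r_neg)
  then show ?thesis
    \<comment> \<open>\<open>U_smult\<close> multiplies by the class of a scalar, which is the map
      \<open>s\<close> of this interpretation.\<close>
    by (simp only: U.capelli_sum_def U.capelli_term_def U_smult_def a_def b_def flip: U_def)
qed

end
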